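(* Let $\mathcal H$ be a real Hilbert space, $C\subseteq\mathcal H$ nonempty, closed and convex, and $F:\mathcal H\to\mathcal H$. Assume that $SOL(C,F)\neq\emptyset$, that $F$ is monotone on $\mathcal H$ ($\langle F(x)-F(y),x-y\rangle\ge 0$ for all $x,y\in\mathcal H$), and that $F$ is Lipschitz continuous on $\mathcal H$ with some constant $L>0$. Assume that the sequence $\{\alpha_k\}_{k=0}^\infty\subset[0,1]$ satisfies $$\sum_{k=0}^\infty\alpha_k\|x^k-x^{k-1}\|<+\infty.$$ Then any sequence $\{x^k\}_{k=0}^\infty$ generated by the inertial PC-algorithm II (iPC II-2) described in the context converges weakly to a point of $SOL(C,F)$, i.e. to a solution of the variational inequality problem.
   Context: The variational inequality problem is: find $x^*\in C$ with $\langle F(x^* ),x-x^*\rangle\ge 0$ for all $x\in C$; its solution set is $SOL(C,F)$. $P_C$ denotes the metric projection onto $C$. Inertial PC-algorithm II (iPC II-2): fix $\nu\in(0,1)$, $\gamma\in(0,2)$ and starting points $x^{-1},x^0\in\mathcal H$. Given $x^{k-1},x^k$, set $$w^k=x^k+\alpha_k(x^k-x^{k-1}),\qquad y^k=P_C(w^k-\beta_kF(w^k)),$$ where $\beta_k>0$ is selected to satisfy $\beta_k\|F(w^k)-F(y^k)\|\le\nu\|w^k-y^k\|$. Define $$d(w^k,y^k)=(w^k-y^k)-\beta_k(F(w^k)-F(y^k)),\qquad \rho_k=\frac{\langle w^k-y^k,d(w^k,y^k)\rangle}{\|d(w^k,y^k)\|^2},$$ $$x^{k+1}=P_C\big(w^k-\gamma\beta_k\rho_kF(y^k)\big).$$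 It is understood that $d(w^k,y^k)\ne0$ for all $k$, so that $\rho_k$ is defined.
   Formalization: The formal theorem additionally assumes that the step sizes β_k are bounded below by some positive constant; without this the claim fails, e.g. F(x)=x on the real line with β_k=2^{-k-2}, α_k=0, γ=1, ν=1/2, x^{-1}=x^0=1, where x^k does not tend to 0. *)

theory Defs
  imports "HOL-Analysis.Analysis"
begin

(* Real Hilbert spaces are rendered by the sort {real_inner, complete_space}, of arbitrary
   (possibly infinite) dimension. The library's closest_point has the same defining formula as
   metric_proj, but it is only available for Heine-Borel, i.e. finite-dimensional, spaces. *)

definition metric_proj :: "'a::{real_inner,complete_space} set \<Rightarrow> 'a \<Rightarrow> 'a"
  where "metric_proj C a = (SOME p. p \<in> C \<and> (\<forall>z\<in>C. dist a p \<le> dist a z))"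

definition SOL :: "'a::real_inner set \<Rightarrow> ('a \<Rightarrow> 'a) \<Rightarrow> 'a set"
  where "SOL C F = {s \<in> C. \<forall>x\<in>C. inner (F s) (x - s) \<ge> 0}"

definition monotone_operator :: "('a::real_inner \<Rightarrow> 'a) \<Rightarrow> bool"
  where "monotone_operator F \<longleftrightarrow> (\<forall>x y. inner (F x - F y) (x - y) \<ge> 0)"

definition weakly_converges_to :: "(nat \<Rightarrow> 'a::real_inner) \<Rightarrow> 'a \<Rightarrow> bool"
  where "weakly_converges_to x p \<longleftrightarrow> (\<forall>v. (\<lambda>k. inner (x k) v) \<longlonglongrightarrow> inner p v)"

(* The iterate of index k - 1, where xm1 is the extra starting point of index -1. *)
definition prev_iterate :: "'a \<Rightarrow> (nat \<Rightarrow> 'a) \<Rightarrow> nat \<Rightarrow> 'a"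
  where "prev_iterate xm1 x k = (case k of 0 \<Rightarrow> xm1 | Suc j \<Rightarrow> x j)"

definition pc_dir :: "('a::real_inner \<Rightarrow> 'a) \<Rightarrow> real \<Rightarrow> 'a \<Rightarrow> 'a \<Rightarrow> 'a"
  where "pc_dir F b w y = (w - y) - b *\<^sub>R (F w - F y)"

definition pc_rho :: "('a::real_inner \<Rightarrow> 'a) \<Rightarrow> real \<Rightarrow> 'a \<Rightarrow> 'a \<Rightarrow> real"
  where "pc_rho F b w y = inner (w - y) (pc_dir F b w y) / (norm (pc_dir F b w y))\<^sup>2"

(* x, w, y is a run of algorithm iPC II-2 with starting points xm1 and x 0, extrapolation
   factors \<alpha> and step sizes \<beta>. The step sizes are any positive numbers passing the acceptance
   test, which alone does not keep them away from 0: for F = id on the real line and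
   \<beta> k = 1 / 2^(k+2), \<gamma> = 1, \<nu> = 1/2, \<alpha> = 0, the iterates do not tend to the solution 0.
   Convergence therefore needs a positive lower bound on \<beta> as a separate hypothesis. *)
definition iPC_II_2 ::
  "'a::{real_inner,complete_space} set \<Rightarrow> ('a \<Rightarrow> 'a) \<Rightarrow> real \<Rightarrow> real \<Rightarrow> (nat \<Rightarrow> real) \<Rightarrow>
    (nat \<Rightarrow> real) \<Rightarrow> 'a \<Rightarrow> (nat \<Rightarrow> 'a) \<Rightarrow> (nat \<Rightarrow> 'a) \<Rightarrow> (nat \<Rightarrow> 'a) \<Rightarrow> bool"
  where "iPC_II_2 C F \<nu> \<gamma> \<alpha> \<beta> xm1 x w y \<longleftrightarrow>
    (\<forall>k. w k = x k + \<alpha> k *\<^sub>R (x k - prev_iterate xm1 x k) \<and>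
         y k = metric_proj C (w k - \<beta> k *\<^sub>R F (w k)) \<and>
         \<beta> k > 0 \<and>
         \<beta> k * norm (F (w k) - F (y k)) \<le> \<nu> * norm (w k - y k) \<and>
         pc_dir F (\<beta> k) (w k) (y k) \<noteq> 0 \<and>
         x (Suc k) =
           metric_proj C (w k - (\<gamma> * \<beta> k * pc_rho F (\<beta> k) (w k) (y k)) *\<^sub>R F (y k)))"

end

theory Submission
  imports Defs
begin

text \<open>
  Two estimates drive the proof. First, for every solution \<open>u\<close> one iteration satisfies
  \<open>\<parallel>x (k+1) - u\<parallel>\<^sup>2 \<le> \<parallel>w k - u\<parallel>\<^sup>2 - c \<parallel>w k - y k\<parallel>\<^sup>2\<close> with a fixed \<open>c > 0\<close>
  (lemma \<open>pc_step_decrease\<close>): with \<open>d\<close> the direction \<open>pc_dir\<close> at \<open>w k\<close> and \<open>y k\<close>,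
  the half-space \<open>{v. d \<bullet> (v - y k) \<le> 0}\<close> contains \<open>u\<close> but not \<open>w k\<close>, the value \<open>\<rho> k\<close>
  makes \<open>w k - \<rho> k d\<close> the projection of \<open>w k\<close> onto it, and the actual step along \<open>F (y k)\<close>
  obeys the same descent estimate as that projection relaxed by the factor \<open>\<gamma>\<close>.
  As \<open>w k\<close> is within the summable distance \<open>\<alpha> k \<parallel>x k - x (k-1)\<parallel>\<close> of \<open>x k\<close>, the distances \<open>\<parallel>x k - u\<parallel>\<close>
  converge for every solution \<open>u\<close>; the distances \<open>\<parallel>w k - u\<parallel>\<close> have the same limit, so
  \<open>w k - y k\<close> tends to 0.

  Second, \<open>y k\<close> satisfies the inequality \<open>F z \<bullet> (z - y k) \<ge> 0\<close>, for each \<open>z\<close> in \<open>C\<close>, up to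
  an error of order \<open>\<parallel>w k - y k\<parallel> \<parallel>z - y k\<parallel>\<close> (lemma \<open>proj_step_almost_minty\<close>). This is where
  the lower bound on the step sizes enters. In the limit the error vanishes, and what is left is
  Minty's form of the variational inequality, whose solutions are the points of
  \<open>SOL C F\<close> (lemma \<open>minty\<close>).

  The two are combined by Opial's argument: limit points are solutions, and convergence of the
  distances to all solutions leaves room for only one of them. Instead of weak cluster points
  the argument uses points of \<open>\<Inter>n. closure (convex hull {x k | k \<ge> n})\<close>. Every bounded
  sequence in a Hilbert space has such a point, because nested closed convex sets that meet a
  common ball have a common point; and although such a point need not be a weak cluster point,
  it inherits every linear inequality that the sequence satisfies asymptotically, and membership in
  \<open>C\<close>, Minty's inequalities and the separation of two candidate limits are all of this kind. The
  lemma on nested sets, applied to a constant sequence of sets, also yields the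
  existence of the metric projection.
\<close>

section \<open>Nested closed convex sets and the metric projection\<close>

text \<open>
  Points \<open>z n \<in> K n\<close> that almost realise the distance from \<open>a\<close> form a Cauchy sequence: the
  distances from \<open>a\<close> to \<open>K n\<close> increase to a limit, and for \<open>n \<le> m\<close> the midpoint of
  \<open>z n\<close> and \<open>z m\<close> lies in \<open>K n\<close>, so the parallelogram law bounds \<open>\<parallel>z n - z m\<parallel>\<close>. The bound \<open>B\<close>
  prevents the sets from escaping to infinity.
\<close>

lemma nested_convex_closest_point:
  fixes K :: "nat \<Rightarrow> 'a::{real_inner,complete_space} set"
  assumes "decseq K" and closed: "\<And>n. closed (K n)" and "\<And>n. convex (K n)"
    and near: "\<And>n. \<exists>z\<in>K n. dist a z \<le> B"
  shows "\<exists>q\<in>\<Inter>n. K n. \<forall>z\<in>\<Inter>n. K n. dist a q \<le> dist a z"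
proof -
  define d where "d n = infdist a (K n)" for n
  define g where "g n = d n + 1 / real (Suc n)" for n
  have ne: "K n \<noteq> {}" for n using near by blast
  have dK: "d n \<le> dist a z" if "z \<in> K n" for n z
    unfolding d_def using that by (rule infdist_le)
  have d0: "0 \<le> d n" for n by (simp add: d_def infdist_nonneg)
  have "d n \<le> B" for n using near[of n] dK[of _ n] by (meson order_trans)
  moreover have "incseq d"
    unfolding d_def incseq_def using infdist_mono \<open>decseq K\<close> ne by (metis decseq_def)
  ultimately obtain D where D: "d \<longlonglongrightarrow> D" by (meson incseq_convergent)
  have g: "g \<longlonglongrightarrow> D"
    unfolding g_def using tendsto_add[OF D LIMSEQ_Suc[OF lim_1_over_n]] by simp
  have "\<exists>z\<in>K n. dist a z < g n" for n
  proof (rule ccontr)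
    assume "\<not> ?thesis"
    then have "g n \<le> d n"
      unfolding d_def infdist_notempty[OF ne] by (intro cINF_greatest) (use ne in \<open>auto simp: not_less\<close>)
    then show False by (simp add: g_def divide_le_0_iff)
  qed
  then obtain z where zK: "z n \<in> K n" and zg: "dist a (z n) < g n" for n by metis
  have dist_z: "(dist (z n) (z m))\<^sup>2 \<le> 2 * (g n)\<^sup>2 + 2 * (g m)\<^sup>2 - 4 * (d n)\<^sup>2" if "n \<le> m" for n m
  proof -
    define c where "c = (1/2) *\<^sub>R z n + (1/2) *\<^sub>R z m"
    have "z m \<in> K n" using zK[of m] decseqD[OF \<open>decseq K\<close> that] by blast
    then have "c \<in> K n"
      unfolding c_def using zK[of n] \<open>convex (K n)\<close> by (intro convexD) auto
    then have "(d n)\<^sup>2 \<le> (norm (a - c))\<^sup>2"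
      using dK d0 by (simp add: dist_norm power_mono)
    moreover have "(norm (a - z k))\<^sup>2 \<le> (g k)\<^sup>2" for k
      using zg[of k] by (intro power_mono) (auto simp: dist_norm)
    moreover have "(dist (z n) (z m))\<^sup>2
        = 2 * (norm (a - z n))\<^sup>2 + 2 * (norm (a - z m))\<^sup>2 - 4 * (norm (a - c))\<^sup>2"
      unfolding dist_norm power2_norm_eq_inner c_def
      by (simp add: inner_diff_left inner_diff_right inner_add_left inner_add_right
          inner_commute algebra_simps)
    ultimately show ?thesis using \<open>\<And>k. (norm (a - z k))\<^sup>2 \<le> (g k)\<^sup>2\<close>[of n]
      \<open>\<And>k. (norm (a - z k))\<^sup>2 \<le> (g k)\<^sup>2\<close>[of m] by linarith
  qed
  have "Cauchy z"
    unfolding Cauchy_altdef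
  proof (intro allI impI)
    fix e :: real assume "0 < e"
    then have e: "0 < e\<^sup>2 / 8" by simp
    have "(\<lambda>n. (g n)\<^sup>2) \<longlonglongrightarrow> D\<^sup>2" "(\<lambda>n. (d n)\<^sup>2) \<longlonglongrightarrow> D\<^sup>2"
      by (intro tendsto_intros g D)+
    then have "\<forall>\<^sub>F n in sequentially. (g n)\<^sup>2 < D\<^sup>2 + e\<^sup>2 / 8 \<and> D\<^sup>2 - e\<^sup>2 / 8 < (d n)\<^sup>2"
      using e by (intro eventually_conj order_tendstoD) auto
    then obtain M where M: "\<And>n. n \<ge> M \<Longrightarrow> (g n)\<^sup>2 < D\<^sup>2 + e\<^sup>2 / 8 \<and> D\<^sup>2 - e\<^sup>2 / 8 < (d n)\<^sup>2"
      by (auto simp: eventually_sequentially)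
    have "dist (z n) (z m) < e" if "n \<ge> M" "m > n" for n m
    proof -
      have "(dist (z n) (z m))\<^sup>2 < e\<^sup>2"
        using dist_z[of n m] M[of n] M[of m] that by linarith
      then show ?thesis using \<open>0 < e\<close> by (simp add: power2_less_imp_less)
    qed
    then show "\<exists>M. \<forall>m\<ge>M. \<forall>n>m. dist (z m) (z n) < e" by blast
  qed
  then obtain q where q: "z \<longlonglongrightarrow> q" using Cauchy_convergent convergent_def by blast
  have "q \<in> K n" for n
  proof (rule Lim_in_closed_set[OF closed[of n] _ _ q])
    show "\<forall>\<^sub>F m in sequentially. z m \<in> K n"
      using eventually_ge_at_top[of n]
      by eventually_elim (use zK decseqD[OF \<open>decseq K\<close>] in blast)
  qed simp
  moreover have "dist a q \<le> dist a u" if "u \<in> (\<Inter>n. K n)" for u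
  proof -
    have "dist a q \<le> D"
      using tendsto_dist[OF tendsto_const q] g by (rule LIMSEQ_le) (use zg less_imp_le in blast)
    also have "D \<le> dist a u"
      using D by (rule LIMSEQ_le_const2) (use dK that in blast)
    finally show ?thesis .
  qed
  ultimately show ?thesis by blast
qed

text \<open>The second fact is the obtuse-angle property, the form in which projections are used below.\<close>

lemma metric_proj:
  fixes C :: "'a::{real_inner,complete_space} set"
  assumes "C \<noteq> {}" "closed C" "convex C"
  shows metric_proj_mem: "metric_proj C a \<in> C"
    and metric_proj_obtuse: "z \<in> C \<Longrightarrow> inner (a - metric_proj C a) (z - metric_proj C a) \<le> 0"
proof -
  obtain c where "c \<in> C" using assms by blast
  then have "\<exists>q\<in>\<Inter>n::nat. C. \<forall>z\<in>\<Inter>n::nat. C. dist a q \<le> dist a z"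
    using assms by (intro nested_convex_closest_point[where B = "dist a c"]) auto
  then have "\<exists>p. p \<in> C \<and> (\<forall>z\<in>C. dist a p \<le> dist a z)" by auto
  from someI_ex[OF this]
  have p: "metric_proj C a \<in> C \<and> (\<forall>z\<in>C. dist a (metric_proj C a) \<le> dist a z)"
    unfolding metric_proj_def .
  then show "metric_proj C a \<in> C" by blast
  show "inner (a - metric_proj C a) (z - metric_proj C a) \<le> 0" if "z \<in> C"
    using any_closest_point_dot[of C "metric_proj C a" z a] p that assms by blast
qed

section \<open>Closed convex hulls of tails and Opial's lemma\<close>

lemma bounded_imp_tail_hulls_meet:
  fixes x :: "nat \<Rightarrow> 'a::{real_inner,complete_space}"
  assumes "bounded (range x)"
  shows "(\<Inter>n. closure (convex hull (x ` {n..}))) \<noteq> {}"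
proof -
  obtain B where B: "\<And>k. norm (x k) \<le> B"
    using assms by (auto simp: bounded_iff)
  have "\<exists>z\<in>closure (convex hull (x ` {n..})). dist 0 z \<le> B" for n
  proof
    show "x n \<in> closure (convex hull (x ` {n..}))"
      using hull_subset[of "x ` {n..}" convex] closure_subset[of "convex hull (x ` {n..})"] by auto
  qed (use B in simp)
  note near = this
  have "decseq (\<lambda>n. closure (convex hull (x ` {n..})))"
    unfolding decseq_def by (intro allI impI closure_mono hull_mono image_mono) auto
  from nested_convex_closest_point[OF this closed_closure convex_closure[OF convex_convex_hull] near]
  show ?thesis by blast
qed

lemma tail_hulls_subset:
  assumes "\<forall>\<^sub>F k in sequentially. x k \<in> S" "closed S" "convex S"
  shows "(\<Inter>n. closure (convex hull (x ` {n..}))) \<subseteq> S"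
proof -
  obtain n where "x ` {n..} \<subseteq> S" using assms(1) by (auto simp: eventually_sequentially)
  then have "closure (convex hull (x ` {n..})) \<subseteq> S"
    using assms by (intro closure_minimal hull_minimal) auto
  then show ?thesis by blast
qed

text \<open>
  The bound may depend on the index as long as it converges: passing to the half-space
  \<open>{u. v \<bullet> u \<le> l + e}\<close> with \<open>e > 0\<close> absorbs the difference.
\<close>

lemma tail_hulls_inner_le:
  assumes q: "q \<in> (\<Inter>n. closure (convex hull (x ` {n..})))"
    and le: "\<forall>\<^sub>F k in sequentially. inner v (x k) \<le> c k" and c: "c \<longlonglongrightarrow> l"
  shows "inner v q \<le> l"
proof (rule field_le_epsilon)
  fix e :: real assume "e > 0"
  then have "\<forall>\<^sub>F k in sequentially. c k < l + e" using c by (intro order_tendstoD) auto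
  with le have "\<forall>\<^sub>F k in sequentially. x k \<in> {u. inner v u \<le> l + e}"
    by eventually_elim simp
  from tail_hulls_subset[OF this closed_halfspace_le convex_halfspace_le] q
  show "inner v q \<le> l + e" by blast
qed

lemma tail_hulls_inner_eq:
  assumes "q \<in> (\<Inter>n. closure (convex hull (x ` {n..})))"
    and lim: "(\<lambda>k. inner v (x k)) \<longlonglongrightarrow> l"
  shows "inner v q = l"
proof (rule antisym)
  show "inner v q \<le> l" using tail_hulls_inner_le[OF assms(1) _ lim] by simp
  have "inner (- v) q \<le> - l"
    using tail_hulls_inner_le[OF assms(1) _ tendsto_minus[OF lim], of "- v"] by simp
  then show "l \<le> inner v q" by simp
qed

text \<open>
  If \<open>q\<close> and \<open>q'\<close> are in \<open>S\<close>, the difference of the convergent sequences \<open>\<parallel>x k - q'\<parallel>\<^sup>2\<close> and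
  \<open>\<parallel>x k - q\<parallel>\<^sup>2\<close> is affine in \<open>(q - q') \<bullet> x k\<close>, which therefore converges too; if moreover both
  points come from tail hulls of subsequences, then \<open>(q - q') \<bullet> q\<close> and
  \<open>(q - q') \<bullet> q'\<close> both equal its limit, so that \<open>q = q'\<close>. Thus all subsequences
  share one such point \<open>p\<close>, which is the weak limit: a subsequence that stayed on the wrong
  side of a hyperplane off \<open>p\<close> would have its own point there.
\<close>

lemma opial_convergence:
  fixes x :: "nat \<Rightarrow> 'a::{real_inner,complete_space}"
  assumes "S \<noteq> {}"
    and dist: "\<And>u. u \<in> S \<Longrightarrow> convergent (\<lambda>k. norm (x k - u))"
    and tails: "\<And>r q. strict_mono (r :: nat \<Rightarrow> nat) \<Longrightarrow>
       q \<in> (\<Inter>n. closure (convex hull ((\<lambda>k. x (r k)) ` {n..}))) \<Longrightarrow> q \<in> S"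
  shows "\<exists>p\<in>S. weakly_converges_to x p"
proof -
  obtain u where "u \<in> S" using \<open>S \<noteq> {}\<close> by blast
  then have "Bseq (\<lambda>k. norm (x k - u))" using dist by (intro convergent_imp_Bseq)
  then obtain B where B: "\<And>k. norm (x k - u) \<le> B" by (auto simp: Bseq_def)
  have "norm (x k) \<le> B + norm u" for k
    using B[of k] norm_triangle_sub[of "x k" u] by linarith
  then have bdd: "bounded (range (\<lambda>k. x (r k)))" for r :: "nat \<Rightarrow> nat" by (auto simp: bounded_iff)
  have unique: "q = q'"
    if r: "strict_mono (r :: nat \<Rightarrow> nat)" "q \<in> (\<Inter>n. closure (convex hull ((\<lambda>k. x (r k)) ` {n..})))"
      and r': "strict_mono (r' :: nat \<Rightarrow> nat)" "q' \<in> (\<Inter>n. closure (convex hull ((\<lambda>k. x (r' k)) ` {n..})))"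
    for r r' q q'
  proof -
    obtain a b where a: "(\<lambda>k. norm (x k - q)) \<longlonglongrightarrow> a" and b: "(\<lambda>k. norm (x k - q')) \<longlonglongrightarrow> b"
      using dist[OF tails[OF r]] dist[OF tails[OF r']] by (auto simp: convergent_def)
    define l where "l = (b\<^sup>2 - a\<^sup>2 + (norm q)\<^sup>2 - (norm q')\<^sup>2) / 2"
    have "(\<lambda>k. ((norm (x k - q'))\<^sup>2 - (norm (x k - q))\<^sup>2 + (norm q)\<^sup>2 - (norm q')\<^sup>2) / 2) \<longlonglongrightarrow> l"
      unfolding l_def by (intro tendsto_intros a b) simp
    moreover have "((norm (x k - q'))\<^sup>2 - (norm (x k - q))\<^sup>2 + (norm q)\<^sup>2 - (norm q')\<^sup>2) / 2
        = inner (q - q') (x k)" for k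
      unfolding power2_norm_eq_inner
      by (simp add: inner_diff_left inner_diff_right inner_commute field_simps)
    ultimately have lim: "(\<lambda>k. inner (q - q') (x k)) \<longlonglongrightarrow> l" by simp
    have "inner (q - q') q = l" "inner (q - q') q' = l"
      using tail_hulls_inner_eq[OF r(2)] tail_hulls_inner_eq[OF r'(2)]
        LIMSEQ_subseq_LIMSEQ[OF lim r(1)] LIMSEQ_subseq_LIMSEQ[OF lim r'(1)]
      by (auto simp: o_def)
    then have "inner (q - q') (q - q') = 0" by (simp add: inner_diff_right)
    then show "q = q'" by simp
  qed
  have id: "strict_mono (id :: nat \<Rightarrow> nat)" by (simp add: strict_mono_def)
  obtain p where p: "p \<in> (\<Inter>n. closure (convex hull ((\<lambda>k. x (id k)) ` {n..})))"
    using bounded_imp_tail_hulls_meet[OF bdd] by blast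
  have upper: "\<forall>\<^sub>F k in sequentially. inner v (x k) < c" if "inner v p < c" for v c
  proof (rule ccontr)
    assume "\<not> ?thesis"
    then have "infinite {k. c \<le> inner v (x k)}"
      by (simp add: not_eventually not_less flip: frequently_cofinite cofinite_eq_sequentially)
    then obtain r :: "nat \<Rightarrow> nat" where r: "strict_mono r" "\<And>k. c \<le> inner v (x (r k))"
      by (metis infinite_enumerate mem_Collect_eq)
    obtain q where q: "q \<in> (\<Inter>n. closure (convex hull ((\<lambda>k. x (r k)) ` {n..})))"
      using bounded_imp_tail_hulls_meet[OF bdd] by blast
    then have "inner (- v) q \<le> - c"
      by (rule tail_hulls_inner_le[where c = "\<lambda>_. - c"]) (use r in auto)
    with unique[OF r(1) q id p] \<open>inner v p < c\<close> show False by simp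
  qed
  have "(\<lambda>k. inner (x k) v) \<longlonglongrightarrow> inner p v" for v
  proof (rule order_tendstoI)
    fix c
    show "\<forall>\<^sub>F k in sequentially. inner (x k) v < c" if "inner p v < c"
      using upper[of v c] that by (simp add: inner_commute)
    show "\<forall>\<^sub>F k in sequentially. c < inner (x k) v" if "c < inner p v"
      using upper[of "- v" "- c"] that by (simp add: inner_commute)
  qed
  then show ?thesis
    using tails[OF id p] by (auto simp: weakly_converges_to_def)
qed

section \<open>Convergence of almost decreasing sequences\<close>

text \<open>Subtracting the partial sums of \<open>e\<close> turns \<open>a\<close> into a decreasing sequence bounded below.\<close>

lemma convergent_if_summable_increase:
  fixes a e :: "nat \<Rightarrow> real"
  assumes "\<And>k. 0 \<le> a k" "\<And>k. 0 \<le> e k" "summable e" "\<And>k. a (Suc k) \<le> a k + e k"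
  shows "convergent a"
proof -
  have "decseq (\<lambda>k. a k - (\<Sum>i<k. e i))"
  proof (rule decseq_SucI)
    show "a (Suc k) - (\<Sum>i<Suc k. e i) \<le> a k - (\<Sum>i<k. e i)" for k
      using assms(4)[of k] by simp
  qed
  moreover have "- suminf e \<le> a k - (\<Sum>i<k. e i)" for k
    using sum_le_suminf[OF assms(3), of "{..<k}"] assms(1)[of k] assms(2) by simp
  ultimately have "convergent (\<lambda>k. a k - (\<Sum>i<k. e i))"
    by (elim decseq_convergent) (auto simp: convergent_def)
  moreover have "convergent (\<lambda>k. \<Sum>i<k. e i)"
    using assms(3) by (simp add: summable_iff_convergent)
  ultimately have "convergent (\<lambda>k. (a k - (\<Sum>i<k. e i)) + (\<Sum>i<k. e i))" by (rule convergent_add)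
  then show ?thesis by simp
qed

section \<open>Estimates for the variational inequality\<close>

text \<open>
  Minty's lemma. The hypothesis is used at points of the segment from \<open>p\<close> to \<open>z\<close> that tend to
  \<open>p\<close>; there \<open>z - p\<close> is a positive multiple of the displacement, and continuity of
  \<open>F\<close> gives the limit.
\<close>

lemma minty:
  fixes F :: "'a::real_inner \<Rightarrow> 'a"
  assumes "convex C" "continuous_on UNIV F" "p \<in> C"
    and weak: "\<And>z. z \<in> C \<Longrightarrow> 0 \<le> inner (F z) (z - p)"
  shows "p \<in> SOL C F"
  unfolding SOL_def
proof (intro CollectI conjI ballI)
  fix z assume "z \<in> C"
  define s where "s n = p + (1 / real (Suc n)) *\<^sub>R (z - p)" for n
  have "s \<longlonglongrightarrow> p + 0 *\<^sub>R (z - p)"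
    unfolding s_def by (intro tendsto_intros LIMSEQ_Suc[OF lim_1_over_n])
  then have "(\<lambda>n. F (s n)) \<longlonglongrightarrow> F p"
    using assms(2) by (auto intro: continuous_on_tendsto_compose)
  then have lim: "(\<lambda>n. inner (F (s n)) (z - p)) \<longlonglongrightarrow> inner (F p) (z - p)"
    by (intro tendsto_intros)
  have "0 \<le> inner (F (s n)) (z - p)" for n
  proof -
    have "s n = (1 - 1 / real (Suc n)) *\<^sub>R p + (1 / real (Suc n)) *\<^sub>R z"
      by (simp add: s_def algebra_simps)
    also have "\<dots> \<in> C"
      using assms(1,3) \<open>z \<in> C\<close> by (intro convexD) auto
    finally have "0 \<le> inner (F (s n)) (s n - p)" by (rule weak)
    then show ?thesis by (simp add: s_def zero_le_divide_iff)
  qed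
  with lim show "0 \<le> inner (F p) (z - p)" by (intro LIMSEQ_le_const) auto
qed fact

text \<open>
  Write \<open>d\<close> for the direction \<open>pc_dir F b w y\<close>. The difference \<open>d - b F y\<close> is the residual of
  the projection that defines \<open>y\<close>, hence normal to \<open>C\<close> at \<open>y\<close>, so
  \<open>d \<bullet> (x' - y) \<le> b F y \<bullet> (x' - y)\<close>; and monotonicity gives \<open>F y \<bullet> (y - u) \<ge> 0\<close>.
  Completing the square in \<open>w - x' - \<gamma> \<rho> d\<close> and using \<open>\<rho> \<parallel>d\<parallel>\<^sup>2 = (w - y) \<bullet> d\<close> makes the gain
  \<open>\<gamma> (2 - \<gamma>) \<rho>\<^sup>2 \<parallel>d\<parallel>\<^sup>2\<close>. The acceptance test keeps \<open>d\<close> close to \<open>w - y\<close>, namely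
  \<open>(w - y) \<bullet> d \<ge> (1 - \<nu>) \<parallel>w - y\<parallel>\<^sup>2\<close> and \<open>\<parallel>d\<parallel> \<le> (1 + \<nu>) \<parallel>w - y\<parallel>\<close>, whence
  \<open>\<rho> \<parallel>d\<parallel> \<ge> (1 - \<nu>) / (1 + \<nu>) \<parallel>w - y\<parallel>\<close>.
\<close>

lemma pc_step_decrease:
  fixes C :: "'a::{real_inner,complete_space} set"
  assumes C: "C \<noteq> {}" "closed C" "convex C" and "monotone_operator F" "u \<in> SOL C F"
    and \<nu>: "0 < \<nu>" "\<nu> < 1" and \<gamma>: "0 < \<gamma>" "\<gamma> < 2" and "0 < b"
    and y: "y = metric_proj C (w - b *\<^sub>R F w)"
    and test: "b * norm (F w - F y) \<le> \<nu> * norm (w - y)"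
    and "pc_dir F b w y \<noteq> 0"
    and x': "x' = metric_proj C (w - (\<gamma> * b * pc_rho F b w y) *\<^sub>R F y)"
  shows "(norm (x' - u))\<^sup>2
    \<le> (norm (w - u))\<^sup>2 - \<gamma> * (2 - \<gamma>) * ((1 - \<nu>) / (1 + \<nu>))\<^sup>2 * (norm (w - y))\<^sup>2"
proof -
  define d where "d = pc_dir F b w y"
  define \<rho> where "\<rho> = pc_rho F b w y"
  define N where "N = norm (w - y)"
  have d: "d = (w - y) - b *\<^sub>R (F w - F y)" by (simp add: d_def pc_dir_def)
  have dpos: "0 < norm d" using \<open>pc_dir F b w y \<noteq> 0\<close> by (simp add: d_def)
  have \<rho>d: "\<rho> * (norm d)\<^sup>2 = inner (w - y) d"
    using dpos by (simp add: \<rho>_def pc_rho_def d_def)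
  have bF: "norm (b *\<^sub>R (F w - F y)) \<le> \<nu> * N" using test \<open>0 < b\<close> by (simp add: N_def)
  have inner_ge: "(1 - \<nu>) * N\<^sup>2 \<le> inner (w - y) d"
  proof -
    have "inner (w - y) (b *\<^sub>R (F w - F y)) \<le> N * (\<nu> * N)"
      unfolding N_def using bF
      by (intro order_trans[OF norm_cauchy_schwarz] mult_left_mono) (auto simp: N_def)
    moreover have "inner (w - y) d = N\<^sup>2 - inner (w - y) (b *\<^sub>R (F w - F y))"
      unfolding d N_def by (simp only: inner_diff_right power2_norm_eq_inner)
    ultimately show ?thesis by (simp add: power2_eq_square algebra_simps)
  qed
  have norm_d: "norm d \<le> (1 + \<nu>) * N"
    unfolding d using norm_triangle_ineq4[of "w - y" "b *\<^sub>R (F w - F y)"] bF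
    by (simp add: N_def algebra_simps)
  have "0 \<le> inner (w - y) d" using inner_ge \<nu> by (intro order_trans[OF _ inner_ge]) simp
  then have "0 \<le> \<rho>" by (simp add: \<rho>_def pc_rho_def d_def)
  have "(1 - \<nu>) / (1 + \<nu>) * N \<le> \<rho> * norm d"
  proof -
    have "(1 - \<nu>) / (1 + \<nu>) * N * norm d \<le> (1 - \<nu>) / (1 + \<nu>) * N * ((1 + \<nu>) * N)"
      using norm_d \<nu> by (intro mult_left_mono) (auto simp: N_def)
    also have "\<dots> = (1 - \<nu>) * N\<^sup>2" using \<nu> by (simp add: power2_eq_square field_simps)
    also have "\<dots> \<le> \<rho> * norm d * norm d" using inner_ge \<rho>d by (simp add: power2_eq_square mult.assoc)
    finally show ?thesis using dpos by (simp only: mult_le_cancel_right_pos)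
  qed
  then have rate: "((1 - \<nu>) / (1 + \<nu>))\<^sup>2 * N\<^sup>2 \<le> \<rho>\<^sup>2 * (norm d)\<^sup>2"
    using \<nu> power_mono[of "(1 - \<nu>) / (1 + \<nu>) * N" "\<rho> * norm d" 2]
    by (simp only: power_mult_distrib) (simp add: N_def)

  have "u \<in> C" "0 \<le> inner (F u) (y - u)" and yC: "y \<in> C" and x'C: "x' \<in> C"
    using \<open>u \<in> SOL C F\<close> metric_proj_mem[OF C] by (auto simp: SOL_def y x')
  moreover have "0 \<le> inner (F y - F u) (y - u)"
    using \<open>monotone_operator F\<close> by (simp add: monotone_operator_def)
  ultimately have Fyu: "0 \<le> inner (F y) (y - u)" by (simp add: inner_diff_left)
  have "inner (w - b *\<^sub>R F w - y) (x' - y) \<le> 0"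
    unfolding y using x'C by (rule metric_proj_obtuse[OF C])
  then have "inner d (x' - y) \<le> b * inner (F y) (x' - y)"
    by (simp add: d inner_diff_left inner_diff_right algebra_simps)
  also have "\<dots> \<le> b * inner (F y) (x' - u)"
    using Fyu \<open>0 < b\<close> by (simp add: inner_diff_right)
  finally have dir: "\<gamma> * \<rho> * inner d (x' - y) \<le> \<gamma> * \<rho> * (b * inner (F y) (x' - u))"
    using \<gamma> \<open>0 \<le> \<rho>\<close> by (intro mult_left_mono) auto
  have proj: "inner (w - (\<gamma> * b * \<rho>) *\<^sub>R F y - x') (u - x') \<le> 0"
    unfolding x' \<rho>_def using \<open>u \<in> C\<close> by (rule metric_proj_obtuse[OF C])
  have "(norm (x' - u))\<^sup>2 = (norm (w - u))\<^sup>2 - (norm (w - x'))\<^sup>2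
      + 2 * inner (w - (\<gamma> * b * \<rho>) *\<^sub>R F y - x') (u - x')
      - 2 * (\<gamma> * \<rho> * (b * inner (F y) (x' - u)))"
    unfolding power2_norm_eq_inner
    by (simp add: inner_diff_left inner_diff_right inner_commute algebra_simps)
  also have "\<dots> \<le> (norm (w - u))\<^sup>2 - (norm (w - x'))\<^sup>2 - 2 * (\<gamma> * \<rho> * inner d (x' - y))"
    using dir proj by linarith
  also have "\<dots> = (norm (w - u))\<^sup>2 - (norm (w - x' - (\<gamma> * \<rho>) *\<^sub>R d))\<^sup>2
      + (\<gamma> * \<rho>)\<^sup>2 * (norm d)\<^sup>2 - 2 * \<gamma> * \<rho> * inner (w - y) d"
    unfolding power2_norm_eq_inner
    by (simp add: inner_diff_left inner_diff_right inner_commute power2_eq_square algebra_simps)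
  also have "\<dots> \<le> (norm (w - u))\<^sup>2 - \<gamma> * (2 - \<gamma>) * (\<rho>\<^sup>2 * (norm d)\<^sup>2)"
  proof -
    have "(\<gamma> * \<rho>)\<^sup>2 * D - 2 * \<gamma> * \<rho> * (\<rho> * D) = - (\<gamma> * (2 - \<gamma>) * (\<rho>\<^sup>2 * D))" for D
      by (simp add: power2_eq_square algebra_simps)
    from this[of "(norm d)\<^sup>2"] zero_le_power2[of "norm (w - x' - (\<gamma> * \<rho>) *\<^sub>R d)"]
    show ?thesis unfolding \<rho>d by linarith
  qed
  also have "\<dots> \<le> (norm (w - u))\<^sup>2 - \<gamma> * (2 - \<gamma>) * (((1 - \<nu>) / (1 + \<nu>))\<^sup>2 * N\<^sup>2)"
    using rate \<gamma> by (intro diff_left_mono mult_left_mono) auto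
  finally show ?thesis by (simp add: N_def mult.assoc)
qed

text \<open>
  The obtuse-angle property at \<open>y\<close> bounds \<open>F w \<bullet> (z - y)\<close> below by
  \<open>(w - y) \<bullet> (z - y) / \<beta>\<close>; replacing \<open>F w\<close> by \<open>F y\<close> costs a Lipschitz term, and replacing
  \<open>F y\<close> by \<open>F z\<close> costs nothing by monotonicity. The constant is uniform over all \<open>\<beta> \<ge> b\<close>.
\<close>

lemma proj_step_almost_minty:
  fixes C :: "'a::{real_inner,complete_space} set"
  assumes C: "C \<noteq> {}" "closed C" "convex C" and "monotone_operator F" "L-lipschitz_on UNIV F"
    and b: "0 < b" "b \<le> \<beta>" and y: "y = metric_proj C (w - \<beta> *\<^sub>R F w)" and "z \<in> C"
  shows "- ((1 / b + L) * norm (w - y) * norm (z - y)) \<le> inner (F z) (z - y)"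
proof -
  have "0 < \<beta>" using b by simp
  have "inner (w - \<beta> *\<^sub>R F w - y) (z - y) \<le> 0"
    unfolding y using \<open>z \<in> C\<close> by (rule metric_proj_obtuse[OF C])
  then have "inner (w - y) (z - y) / \<beta> \<le> inner (F w) (z - y)"
    using \<open>0 < \<beta>\<close> by (simp add: inner_diff_left pos_divide_le_eq mult.commute)
  moreover have "- (norm (w - y) * norm (z - y) / b) \<le> inner (w - y) (z - y) / \<beta>"
  proof -
    have "- (norm (w - y) * norm (z - y)) / \<beta> \<le> inner (w - y) (z - y) / \<beta>"
      using \<open>0 < \<beta>\<close> Cauchy_Schwarz_ineq2[of "w - y" "z - y"] by (intro divide_right_mono) auto
    moreover have "norm (w - y) * norm (z - y) / \<beta> \<le> norm (w - y) * norm (z - y) / b"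
      using b by (intro divide_left_mono) auto
    ultimately show ?thesis by simp
  qed
  moreover have "inner (F w - F y) (z - y) \<le> L * norm (w - y) * norm (z - y)"
    using lipschitz_onD[OF \<open>L-lipschitz_on UNIV F\<close>, of w y]
    by (intro order_trans[OF norm_cauchy_schwarz] mult_right_mono) (auto simp: dist_norm)
  moreover have "0 \<le> inner (F z - F y) (z - y)"
    using \<open>monotone_operator F\<close> by (simp add: monotone_operator_def)
  ultimately show ?thesis by (simp add: inner_diff_left algebra_simps)
qed

section \<open>Weak convergence of the inertial algorithm\<close>

theorem theorem5p5:
  fixes C :: "'a::{real_inner,complete_space} set"
    and F :: "'a \<Rightarrow> 'a"
    and \<nu> \<gamma> L :: real
    and \<alpha> \<beta> :: "nat \<Rightarrow> real"
    and xm1 :: 'a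
    and x w y :: "nat \<Rightarrow> 'a"
  assumes "C \<noteq> {}" and "closed C" and "convex C"
    and "SOL C F \<noteq> {}"
    and "monotone_operator F"
    and "L > 0" and "L-lipschitz_on UNIV F"
    and "0 < \<nu>" and "\<nu> < 1"
    and "0 < \<gamma>" and "\<gamma> < 2"
    and "\<And>k. 0 \<le> \<alpha> k \<and> \<alpha> k \<le> 1"
    and "iPC_II_2 C F \<nu> \<gamma> \<alpha> \<beta> xm1 x w y"
    and step_sizes_bounded_away_from_0: "\<exists>b>0. \<forall>k. b \<le> \<beta> k"
    and "summable (\<lambda>k. \<alpha> k * norm (x k - prev_iterate xm1 x k))"
  shows "\<exists>p \<in> SOL C F. weakly_converges_to x p"
proof -
  note C = assms(1-3)
  define e where "e k = \<alpha> k * norm (x k - prev_iterate xm1 x k)" for k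
  define c where "c = \<gamma> * (2 - \<gamma>) * ((1 - \<nu>) / (1 + \<nu>))\<^sup>2"
  obtain b where b: "0 < b" "\<And>k. b \<le> \<beta> k" using step_sizes_bounded_away_from_0 by blast
  have e: "summable e" "e \<longlonglongrightarrow> 0" "\<And>k. 0 \<le> e k"
    using assms(12,15) summable_LIMSEQ_zero[OF assms(15)] by (simp_all add: e_def[abs_def])
  have c: "0 < c" using assms(8-11) by (simp add: c_def)
  have w: "w k = x k + \<alpha> k *\<^sub>R (x k - prev_iterate xm1 x k)"
    and y: "y k = metric_proj C (w k - \<beta> k *\<^sub>R F (w k))"
    and x: "x (Suc k) = metric_proj C (w k - (\<gamma> * \<beta> k * pc_rho F (\<beta> k) (w k) (y k)) *\<^sub>R F (y k))"
    and pos: "0 < \<beta> k" and test: "\<beta> k * norm (F (w k) - F (y k)) \<le> \<nu> * norm (w k - y k)"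
    and dir: "pc_dir F (\<beta> k) (w k) (y k) \<noteq> 0" for k
    using assms(13)[unfolded iPC_II_2_def, rule_format, of k]
    by - (elim conjE, assumption)+
  have wx: "norm (w k - x k) = e k" for k
    using assms(12)[of k] by (simp add: w e_def)
  have wu: "\<bar>norm (w k - u) - norm (x k - u)\<bar> \<le> e k" for k u
    using norm_triangle_ineq3[of "w k - u" "x k - u"] wx[of k] by simp
  have decrease: "(norm (x (Suc k) - u))\<^sup>2 \<le> (norm (w k - u))\<^sup>2 - c * (norm (w k - y k))\<^sup>2"
    if "u \<in> SOL C F" for u k
    unfolding c_def
    by (rule pc_step_decrease[OF C assms(5) that assms(8-11) pos y test dir x])
  have conv: "convergent (\<lambda>k. norm (x k - u))" if "u \<in> SOL C F" for u
  proof (rule convergent_if_summable_increase[OF _ e(3,1)])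
    fix k
    have "0 \<le> c * (norm (w k - y k))\<^sup>2" using c by simp
    then have "(norm (x (Suc k) - u))\<^sup>2 \<le> (norm (w k - u))\<^sup>2" using decrease[OF that, of k] by linarith
    then have "norm (x (Suc k) - u) \<le> norm (w k - u)" by (rule power2_le_imp_le) simp
    then show "norm (x (Suc k) - u) \<le> norm (x k - u) + e k" using wu[of k u] by linarith
  qed simp
  obtain u a where u: "u \<in> SOL C F" and a: "(\<lambda>k. norm (x k - u)) \<longlonglongrightarrow> a"
    using assms(4) conv unfolding convergent_def by blast
  have wy: "(\<lambda>k. norm (w k - y k)) \<longlonglongrightarrow> 0"
  proof -
    have "(\<lambda>k. norm (w k - u) - norm (x k - u)) \<longlonglongrightarrow> 0"
      by (rule Lim_null_comparison[OF _ e(2)]) (simp add: wu)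
    from tendsto_add[OF this a] have "(\<lambda>k. norm (w k - u)) \<longlonglongrightarrow> a" by simp
    then have "(\<lambda>k. ((norm (w k - u))\<^sup>2 - (norm (x (Suc k) - u))\<^sup>2) / c) \<longlonglongrightarrow> (a\<^sup>2 - a\<^sup>2) / c"
      using c by (intro tendsto_intros LIMSEQ_Suc[OF a]) auto
    then have lim0: "(\<lambda>k. ((norm (w k - u))\<^sup>2 - (norm (x (Suc k) - u))\<^sup>2) / c) \<longlonglongrightarrow> 0" by simp
    have "(\<lambda>k. (norm (w k - y k))\<^sup>2) \<longlonglongrightarrow> 0"
    proof (rule Lim_null_comparison[OF _ lim0], intro always_eventually allI)
      fix k
      show "norm ((norm (w k - y k))\<^sup>2) \<le> ((norm (w k - u))\<^sup>2 - (norm (x (Suc k) - u))\<^sup>2) / c"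
        using decrease[OF u, of k] c by (simp add: field_simps)
    qed
    then have "(\<lambda>k. sqrt ((norm (w k - y k))\<^sup>2)) \<longlonglongrightarrow> sqrt 0" by (rule tendsto_real_sqrt)
    then show ?thesis by simp
  qed
  show ?thesis
  proof (rule opial_convergence[OF assms(4) conv])
    fix r :: "nat \<Rightarrow> nat" and q
    assume r: "strict_mono r" and q: "q \<in> (\<Inter>n. closure (convex hull ((\<lambda>k. x (r k)) ` {n..})))"
    \<comment> \<open>Every iterate except possibly the starting point is a projection onto \<open>C\<close>.\<close>
    have "\<forall>\<^sub>F k in sequentially. x (r k) \<in> C"
      using eventually_ge_at_top[of 1]
    proof eventually_elim
      case (elim k)
      then have "0 < r k" using seq_suble[OF r, of k] by linarith
      then obtain j where "r k = Suc j" using gr0_conv_Suc by blast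
      then show ?case using x[of j] metric_proj_mem[OF C] by simp
    qed
    from tail_hulls_subset[OF this assms(2,3)] q have "q \<in> C" by (rule subsetD)
    have "0 \<le> inner (F z) (z - q)" if "z \<in> C" for z
    proof -
      \<comment> \<open>Error of the Minty inequality at \<open>y k\<close>, with \<open>\<parallel>z - y k\<parallel>\<close> bounded through the solution
        \<open>u\<close>, plus the cost of moving from \<open>y k\<close> to \<open>x k\<close>.\<close>
      define \<delta> where "\<delta> k = (1 / b + L) * norm (w k - y k) * (norm (z - u) + norm (x k - u) + e k + norm (w k - y k))
         + norm (F z) * (norm (w k - y k) + e k)" for k
      have "\<delta> \<longlonglongrightarrow> (1 / b + L) * 0 * (norm (z - u) + a + 0 + 0) + norm (F z) * (0 + 0)"
        unfolding \<delta>_def by (intro tendsto_intros wy a e)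
      then have lim: "(\<lambda>k. inner (F z) z + \<delta> k) \<longlonglongrightarrow> inner (F z) z + 0" by (intro tendsto_intros) simp
      have "inner (F z) (x k) \<le> inner (F z) z + \<delta> k" for k
      proof -
        have "norm (z - y k) \<le> norm (z - u) + norm (x k - u) + e k + norm (w k - y k)"
          using norm_triangle_ineq4[of "z - u" "x k - u"] norm_triangle_ineq4[of "w k - y k" "w k - x k"]
            norm_triangle_ineq[of "z - x k" "x k - y k"] wx[of k] by simp
        then have "(1 / b + L) * norm (w k - y k) * norm (z - y k)
            \<le> (1 / b + L) * norm (w k - y k) * (norm (z - u) + norm (x k - u) + e k + norm (w k - y k))"
          using b(1) \<open>L > 0\<close> by (intro mult_left_mono) auto
        moreover have "inner (F z) (x k - y k) \<le> norm (F z) * (norm (w k - y k) + e k)"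
        proof (rule order_trans[OF norm_cauchy_schwarz mult_left_mono])
          show "norm (x k - y k) \<le> norm (w k - y k) + e k" using norm_triangle_ineq4[of "w k - y k" "w k - x k"] wx[of k] by simp
        qed simp
        ultimately show ?thesis
          using proj_step_almost_minty[OF C assms(5,7) b y that, of k]
          unfolding \<delta>_def inner_diff_right by linarith
      qed
      then have "inner (F z) q \<le> inner (F z) z + 0"
        by (intro tail_hulls_inner_le[OF q _ LIMSEQ_subseq_LIMSEQ[OF lim r]]) (simp add: o_def)
      then show ?thesis by (simp add: inner_diff_right)
    qed
    then show "q \<in> SOL C F"
      by (rule minty[OF assms(3) lipschitz_on_continuous_on[OF assms(7)] \<open>q \<in> C\<close>])
  qed
qed

end
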